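(* Let $(E,\|\cdot\|)$ be a complete random normed module over $\mathbb K$ ($\mathbb K=\mathbb R$ or $\mathbb C$) with base a probability space $(\Omega,\mathcal F,P)$ and zero element $\theta$. Let $G\subset E$ be nonempty, $L^0$-closed, $\sigma$-stable and essentially bounded (there exists a real $M>0$ such that $\|g\|\le M$ almost surely for all $g\in G$), with $\theta\in G$. Let $f:G\to G$ have the local property, be pointwise, respect $\sigma$-stability, and be fibre-wise continuous. Suppose there exist a sequence of nondecreasing functions $\psi_n:[0,\infty)\to[0,\infty)$, $n\ge1$, converging uniformly on $[0,\infty)$ to a Boyd--Wong function $\psi$, and a set $\Omega_0\subset\Omega$ with $P(\Omega_0)=1$, such that for every $\omega\in\Omega_0$, all $n\ge1$ and all $x,y\in G$, $$\|f^nx-f^ny\|(\omega)\le\psi_n\bigl(\|x-y\|(\omega)\bigr).$$ Then $f$ has a unique fixed point in $G$, and for every $x\in G$ the iterates $f^nx$ converge to this fixed point in the $(\epsilon,\lambda)$-topology as $n\to\infty$.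
   Context: Let $(\Omega,\mathcal F,P)$ be a probability space, $L^0(\mathcal F,\mathbb K)$ the algebra of equivalence classes of $\mathbb K$-valued random variables, $L^0_+(\mathcal F)$ the set of (classes of) nonnegative ones. For $A\in\mathcal F$, $\mathbf 1_A$ denotes the equivalence class of the indicator function of $A$. Random normed module (RN module) over $\mathbb K$ with base $(\Omega,\mathcal F,P)$: a pair $(E,\|\cdot\|)$ where $E$ is a left $L^0(\mathcal F,\mathbb K)$-module and $\|\cdot\|:E\to L^0_+(\mathcal F)$ satisfies, for $x,y\in E$, $\xi\in L^0(\mathcal F,\mathbb K)$: $\|x\|=0$ iff $x=\theta$ (the zero element); $\|\xi x\|=|\xi|\,\|x\|$; $\|x+y\|\le\|x\|+\|y\|$. $(\epsilon,\lambda)$-topology: the linear topology on $E$ generated by the neighbourhoods of zero $N_\theta(\epsilon,\lambda)=\{x\in E: P(\|x\|<\epsilon)\ge 1-\lambda\}$, $\epsilon>0$, $0<\lambda<1$; $x_n\to x$ in it iff $\|x_n-x\|\to0$ in probability. Complete means complete in this topology. $G$ is $L^0$-closed if it is closed in this topology. $G\subset E$ is $\sigma$-stable if for every countable measurable partition $\{A_n\}$ of $\Omega$ and every sequence $\{x_n\}\subset G$ there is a unique $x\in G$, denoted $\sum_n\mathbf 1_{A_n}x_n$, with $\mathbf 1_{A_n}x=\mathbf 1_{A_n}x_n$ for all $n$. $G$ is stable if $\mathbf 1_Ax\in G$ for all $A\in\mathcal F$, $x\in G$. A map $f:G\to E$ has the local property if $G$ is stable and $\mathbf 1_Af(x)=f(\mathbf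 1_Ax)$ for all $A\in\mathcal F$, $x\in G$. A map $f:G\to G$ respects $\sigma$-stability if $f(\sum_n\mathbf 1_{A_n}x_n)=\sum_n\mathbf 1_{A_n}f(x_n)$ for every countable measurable partition $\{A_n\}$ of $\Omega$ and every sequence $\{x_n\}\subset G$. Representatives: for each $x\in G$ a representative $\tilde x:\Omega\to\mathbb R$ is fixed, and $f(x)(\omega)$ denotes the value at $\omega$ of the representative of $f(x)$; $\|x\|(\omega)$ denotes the value at $\omega$ of a fixed representative of $\|x\|$. A map $f:G\to G$ is pointwise if there is an $\mathcal F\otimes\mathcal B(\mathbb R)$-measurable function $\tilde f:\Omega\times\mathbb R\to\mathbb R$ such that for every $x\in G$ and a.e. $\omega$, $f(x)(\omega)=\tilde f(\omega,\tilde x(\omega))$. It is fibre-wise continuous if for a.e. $\omega$ the map $x\mapsto f(x)(\omega)$ is continuous from $(G,\|\cdot\|(\omega))$ to itself, i.e. $f$ is continuous on $G$ with respect to the pseudometric $(x,y)\mapsto\|x-y\|(\omega)$. Boyd--Wong function: a function $\psi:[0,\infty)\to[0,\infty)$ that is nondecreasing, right upper semicontinuous, and satisfies $\psi(t)<t$ for all $t>0$. Here $f^n$ is the $n$-fold iterate of $f$. *)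

theory Defs
  imports "HOL-Probability.Probability" "HOL-Algebra.Module"
begin

text \<open>
  The scalar field is a type \<open>'k\<close> of class \<open>{real_normed_field, second_countable_topology}\<close>. By the
  Gelfand--Mazur theorem a commutative real normed field (multiplicative norm) is isometrically
  isomorphic to the real or the complex numbers, and both \<open>real\<close> and \<open>complex\<close> are instances, so
  this is the case distinction \<open>\<bbbK> = \<real>\<close> or \<open>\<bbbK> = \<complex>\<close>; the second class is only needed for
  Borel measurability of the field operations.
\<close>

definition ae_rel :: "'w measure \<Rightarrow> (('w \<Rightarrow> 'k::topological_space) \<times> ('w \<Rightarrow> 'k)) set" where
  "ae_rel M = {(f, g). f \<in> borel_measurable M \<and> g \<in> borel_measurable M \<and> (AE w in M. f w = g w)}"

definition l0_class :: "'w measure \<Rightarrow> ('w \<Rightarrow> 'k::topological_space) \<Rightarrow> ('w \<Rightarrow> 'k) set" where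
  "l0_class M f = ae_rel M `` {f}"

definition L0 ::
  "'w measure \<Rightarrow> ('w \<Rightarrow> 'k::{real_normed_field, second_countable_topology}) set ring" where
  "L0 M = \<lparr>carrier = borel_measurable M // ae_rel M,
           mult = (\<lambda>X Y. \<Union>f\<in>X. \<Union>g\<in>Y. l0_class M (\<lambda>w. f w * g w)),
           one = l0_class M (\<lambda>_. 1),
           zero = l0_class M (\<lambda>_. 0),
           add = (\<lambda>X Y. \<Union>f\<in>X. \<Union>g\<in>Y. l0_class M (\<lambda>w. f w + g w))\<rparr>"

definition L0_plus :: "'w measure \<Rightarrow> ('w \<Rightarrow> real) set set" where
  "L0_plus M = {l0_class M f | f. f \<in> borel_measurable M \<and> (\<forall>w\<in>space M. 0 \<le> f w)}"

definition l0_abs :: "'w measure \<Rightarrow> ('w \<Rightarrow> 'k::real_normed_vector) set \<Rightarrow> ('w \<Rightarrow> real) set" where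
  "l0_abs M X = (\<Union>f\<in>X. l0_class M (\<lambda>w. norm (f w)))"

definition l0_le :: "'w measure \<Rightarrow> ('w \<Rightarrow> real) set \<Rightarrow> ('w \<Rightarrow> real) set \<Rightarrow> bool" where
  "l0_le M X Y \<longleftrightarrow> (\<forall>f\<in>X. \<forall>g\<in>Y. AE w in M. f w \<le> g w)"

lemma equiv_ae_rel: "equiv (borel_measurable M) (ae_rel M)"
  by (rule equivI) (auto simp: ae_rel_def refl_on_def sym_def trans_def elim: AE_mp)

lemma mem_l0_class:
  "g \<in> l0_class M f \<longleftrightarrow>
     f \<in> borel_measurable M \<and> g \<in> borel_measurable M \<and> (AE w in M. f w = g w)"
  by (auto simp: l0_class_def ae_rel_def)

lemma l0_class_eq_iff:
  assumes "f \<in> borel_measurable M" "g \<in> borel_measurable M"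
  shows "l0_class M f = l0_class M g \<longleftrightarrow> (AE w in M. f w = g w)"
  unfolding l0_class_def
  using eq_equiv_class_iff[OF equiv_ae_rel assms] assms by (simp add: ae_rel_def)

lemma l0_lift2:
  fixes op :: "'k::topological_space \<Rightarrow> 'l::topological_space \<Rightarrow> 'm::topological_space"
  assumes f: "f \<in> borel_measurable M" and g: "g \<in> borel_measurable M"
    and op: "\<And>f g. f \<in> borel_measurable M \<Longrightarrow> g \<in> borel_measurable M \<Longrightarrow>
               (\<lambda>w. op (f w) (g w)) \<in> borel_measurable M"
  shows "(\<Union>u\<in>l0_class M f. \<Union>v\<in>l0_class M g. l0_class M (\<lambda>w. op (u w) (v w)))
           = l0_class M (\<lambda>w. op (f w) (g w))"
proof -
  have "l0_class M (\<lambda>w. op (u w) (v w)) = l0_class M (\<lambda>w. op (f w) (g w))"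
    if "u \<in> l0_class M f" "v \<in> l0_class M g" for u v
    using that by (subst l0_class_eq_iff) (auto simp: mem_l0_class op)
  moreover have "f \<in> l0_class M f" "g \<in> l0_class M g"
    using f g by (auto simp: mem_l0_class)
  ultimately show ?thesis by blast
qed

lemma carrier_L0_iff: "X \<in> carrier (L0 M) \<longleftrightarrow> (\<exists>f\<in>borel_measurable M. X = l0_class M f)"
  by (auto simp: L0_def quotient_def l0_class_def)

lemma L0_simps:
  fixes f g :: "'w \<Rightarrow> 'k::{real_normed_field, second_countable_topology}"
  assumes "f \<in> borel_measurable M" "g \<in> borel_measurable M"
  shows "l0_class M f \<otimes>\<^bsub>L0 M\<^esub> l0_class M g = l0_class M (\<lambda>w. f w * g w)"
    and "l0_class M f \<oplus>\<^bsub>L0 M\<^esub> l0_class M g = l0_class M (\<lambda>w. f w + g w)"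
  unfolding L0_def using assms by (simp_all add: l0_lift2)

lemma L0_one: "\<one>\<^bsub>L0 M\<^esub> = l0_class M (\<lambda>_. 1)"
  and L0_zero: "\<zero>\<^bsub>L0 M\<^esub> = l0_class M (\<lambda>_. 0)"
  by (simp_all add: L0_def)

lemma cring_L0:
  "cring (L0 M :: ('w \<Rightarrow> 'k::{real_normed_field, second_countable_topology}) set ring)"
proof (rule cringI)
  show "abelian_group (L0 M :: ('w \<Rightarrow> 'k) set ring)"
  proof (rule abelian_groupI)
    fix X :: "('w \<Rightarrow> 'k) set" assume "X \<in> carrier (L0 M)"
    then obtain f where "f \<in> borel_measurable M" "X = l0_class M f"
      by (auto simp: carrier_L0_iff)
    then show "\<exists>Y\<in>carrier (L0 M). Y \<oplus>\<^bsub>L0 M\<^esub> X = \<zero>\<^bsub>L0 M\<^esub>"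
      by (intro bexI[of _ "l0_class M (\<lambda>w. - f w)"]) (auto simp: carrier_L0_iff L0_simps L0_zero)
  qed (auto simp: carrier_L0_iff L0_simps L0_zero algebra_simps)
  show "Group.comm_monoid (L0 M :: ('w \<Rightarrow> 'k) set ring)"
    by (rule comm_monoidI) (auto simp: carrier_L0_iff L0_simps L0_one algebra_simps)
qed (auto simp: carrier_L0_iff L0_simps algebra_simps)

locale rn_module = prob_space M + Module.module "L0 M" E
  for M :: "'w measure"
    and E :: "(('w \<Rightarrow> 'k::{real_normed_field, second_countable_topology}) set, 'e) module" +
  fixes nrm :: "'e \<Rightarrow> ('w \<Rightarrow> real) set"
  assumes nrm_nonneg: "x \<in> carrier E \<Longrightarrow> nrm x \<in> L0_plus M"
    and nrm_eq_zero: "x \<in> carrier E \<Longrightarrow> nrm x = \<zero>\<^bsub>L0 M\<^esub> \<longleftrightarrow> x = \<zero>\<^bsub>E\<^esub>"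
    and nrm_smult: "a \<in> carrier (L0 M) \<Longrightarrow> x \<in> carrier E \<Longrightarrow>
          nrm (a \<odot>\<^bsub>E\<^esub> x) = l0_abs M a \<otimes>\<^bsub>L0 M\<^esub> nrm x"
    and nrm_triangle: "x \<in> carrier E \<Longrightarrow> y \<in> carrier E \<Longrightarrow>
          l0_le M (nrm (x \<oplus>\<^bsub>E\<^esub> y)) (nrm x \<oplus>\<^bsub>L0 M\<^esub> nrm y)"

text \<open>
  The parameter \<open>\<delta>\<close> plays the role of \<open>\<lambda>\<close>. All representatives of
  \<open>nrm x\<close> give the same probability, so the choice of \<open>r\<close> is immaterial.
\<close>

definition el_nbhd ::
  "'w measure \<Rightarrow> ('k, 'e) module \<Rightarrow> ('e \<Rightarrow> ('w \<Rightarrow> real) set) \<Rightarrow> real \<Rightarrow> real \<Rightarrow> 'e set" where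
  "el_nbhd M E nrm \<epsilon> \<delta> =
     {x \<in> carrier E. \<exists>r\<in>nrm x. measure M {w \<in> space M. r w < \<epsilon>} \<ge> 1 - \<delta>}"

definition el_open ::
  "'w measure \<Rightarrow> ('k, 'e) module \<Rightarrow> ('e \<Rightarrow> ('w \<Rightarrow> real) set) \<Rightarrow> 'e set \<Rightarrow> bool" where
  "el_open M E nrm U \<longleftrightarrow> U \<subseteq> carrier E \<and>
     (\<forall>x\<in>U. \<exists>\<epsilon> \<delta>. 0 < \<epsilon> \<and> 0 < \<delta> \<and> \<delta> < 1 \<and>
        (\<lambda>z. x \<oplus>\<^bsub>E\<^esub> z) ` el_nbhd M E nrm \<epsilon> \<delta> \<subseteq> U)"

definition el_topology ::
  "'w measure \<Rightarrow> ('k, 'e) module \<Rightarrow> ('e \<Rightarrow> ('w \<Rightarrow> real) set) \<Rightarrow> 'e topology" where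
  "el_topology M E nrm = topology (el_open M E nrm)"

lemma (in rn_module) el_nbhd_mono:
  assumes "\<epsilon> \<le> \<epsilon>'" "\<delta> \<le> \<delta>'"
  shows "el_nbhd M E nrm \<epsilon> \<delta> \<subseteq> el_nbhd M E nrm \<epsilon>' \<delta>'"
proof
  fix x assume "x \<in> el_nbhd M E nrm \<epsilon> \<delta>"
  then obtain r where x: "x \<in> carrier E" and r: "r \<in> nrm x"
    and p: "measure M {w \<in> space M. r w < \<epsilon>} \<ge> 1 - \<delta>"
    by (auto simp: el_nbhd_def)
  have [measurable]: "r \<in> borel_measurable M"
    using nrm_nonneg[OF x] r by (auto simp: L0_plus_def mem_l0_class)
  have "measure M {w \<in> space M. r w < \<epsilon>} \<le> measure M {w \<in> space M. r w < \<epsilon>'}"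
    using assms by (intro finite_measure_mono) auto
  with x r p assms show "x \<in> el_nbhd M E nrm \<epsilon>' \<delta>'"
    by (auto simp: el_nbhd_def intro!: bexI[of _ r])
qed

lemma (in rn_module) openin_el_topology: "openin (el_topology M E nrm) = el_open M E nrm"
  unfolding el_topology_def
proof (rule topology_inverse', unfold istopology_def, intro conjI allI impI)
  fix U V assume UV: "el_open M E nrm U" "el_open M E nrm V"
  show "el_open M E nrm (U \<inter> V)"
    unfolding el_open_def
  proof (intro conjI ballI)
    show "U \<inter> V \<subseteq> carrier E" using UV by (auto simp: el_open_def)
    fix x assume "x \<in> U \<inter> V"
    then obtain e l e' l' where
      1: "0 < e" "0 < l" "l < 1" "(\<lambda>z. x \<oplus>\<^bsub>E\<^esub> z) ` el_nbhd M E nrm e l \<subseteq> U" and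
      2: "0 < e'" "0 < l'" "l' < 1" "(\<lambda>z. x \<oplus>\<^bsub>E\<^esub> z) ` el_nbhd M E nrm e' l' \<subseteq> V"
      using UV by (fastforce simp: el_open_def)
    have "el_nbhd M E nrm (min e e') (min l l') \<subseteq> el_nbhd M E nrm e l \<inter> el_nbhd M E nrm e' l'"
      by (intro Int_greatest el_nbhd_mono) auto
    with 1(4) 2(4) have
      "(\<lambda>z. x \<oplus>\<^bsub>E\<^esub> z) ` el_nbhd M E nrm (min e e') (min l l') \<subseteq> U \<inter> V"
      by (meson Int_greatest image_mono le_infE subset_trans)
    with 1(1-3) 2(1-3) show "\<exists>\<epsilon> \<delta>. 0 < \<epsilon> \<and> 0 < \<delta> \<and> \<delta> < 1 \<and>
        (\<lambda>z. x \<oplus>\<^bsub>E\<^esub> z) ` el_nbhd M E nrm \<epsilon> \<delta> \<subseteq> U \<inter> V"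
      by - (rule exI[of _ "min e e'"], rule exI[of _ "min l l'"], auto)
  qed
next
  fix K assume K: "\<forall>U\<in>K. el_open M E nrm U"
  then show "el_open M E nrm (\<Union>K)"
    unfolding el_open_def by (meson Sup_least UnionE Union_upper subset_trans)
qed

text \<open>
  The topology is metrizable, so completeness is expressed by Cauchy sequences (with respect to the
  uniformity of the linear topology).
\<close>

definition el_complete ::
  "'w measure \<Rightarrow> ('k, 'e) module \<Rightarrow> ('e \<Rightarrow> ('w \<Rightarrow> real) set) \<Rightarrow> bool" where
  "el_complete M E nrm \<longleftrightarrow>
     (\<forall>x :: nat \<Rightarrow> 'e. range x \<subseteq> carrier E \<and>
        (\<forall>\<epsilon> \<delta>. 0 < \<epsilon> \<and> 0 < \<delta> \<and> \<delta> < 1 \<longrightarrow>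
           (\<exists>N. \<forall>m\<ge>N. \<forall>n\<ge>N. x m \<ominus>\<^bsub>E\<^esub> x n \<in> el_nbhd M E nrm \<epsilon> \<delta>)) \<longrightarrow>
        (\<exists>l. limitin (el_topology M E nrm) x l sequentially))"

text \<open>Empty pieces are allowed, so that finite partitions are included.\<close>

definition measurable_partition :: "'w measure \<Rightarrow> (nat \<Rightarrow> 'w set) \<Rightarrow> bool" where
  "measurable_partition M A \<longleftrightarrow>
     range A \<subseteq> sets M \<and> disjoint_family A \<and> (\<Union>n. A n) = space M"

definition restr ::
  "'w measure \<Rightarrow> (('w \<Rightarrow> 'k::{topological_space, zero_neq_one}) set, 'e) module \<Rightarrow> 'w set \<Rightarrow> 'e \<Rightarrow> 'e"
  where "restr M E A x = l0_class M (indicator A) \<odot>\<^bsub>E\<^esub> x"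

definition sigma_stable ::
  "'w measure \<Rightarrow> (('w \<Rightarrow> 'k::{topological_space, zero_neq_one}) set, 'e) module \<Rightarrow> 'e set \<Rightarrow> bool" where
  "sigma_stable M E G \<longleftrightarrow>
     (\<forall>A x. measurable_partition M A \<and> range x \<subseteq> G \<longrightarrow>
        (\<exists>!z. z \<in> G \<and> (\<forall>n. restr M E (A n) z = restr M E (A n) (x n))))"

definition glue ::
  "'w measure \<Rightarrow> (('w \<Rightarrow> 'k::{topological_space, zero_neq_one}) set, 'e) module \<Rightarrow> 'e set \<Rightarrow>
   (nat \<Rightarrow> 'w set) \<Rightarrow> (nat \<Rightarrow> 'e) \<Rightarrow> 'e" where
  "glue M E G A x = (THE z. z \<in> G \<and> (\<forall>n. restr M E (A n) z = restr M E (A n) (x n)))"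

definition stable ::
  "'w measure \<Rightarrow> (('w \<Rightarrow> 'k::{topological_space, zero_neq_one}) set, 'e) module \<Rightarrow> 'e set \<Rightarrow> bool" where
  "stable M E G \<longleftrightarrow> (\<forall>A\<in>sets M. \<forall>x\<in>G. restr M E A x \<in> G)"

definition local_property ::
  "'w measure \<Rightarrow> (('w \<Rightarrow> 'k::{topological_space, zero_neq_one}) set, 'e) module \<Rightarrow> 'e set \<Rightarrow>
   ('e \<Rightarrow> 'e) \<Rightarrow> bool" where
  "local_property M E G f \<longleftrightarrow>
     stable M E G \<and> (\<forall>A\<in>sets M. \<forall>x\<in>G. restr M E A (f x) = f (restr M E A x))"

definition respects_sigma_stability ::
  "'w measure \<Rightarrow> (('w \<Rightarrow> 'k::{topological_space, zero_neq_one}) set, 'e) module \<Rightarrow> 'e set \<Rightarrow>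
   ('e \<Rightarrow> 'e) \<Rightarrow> bool" where
  "respects_sigma_stability M E G f \<longleftrightarrow>
     (\<forall>A x. measurable_partition M A \<and> range x \<subseteq> G \<longrightarrow>
        f (glue M E G A x) = glue M E G A (\<lambda>n. f (x n)))"

definition ess_bounded ::
  "'w measure \<Rightarrow> ('e \<Rightarrow> ('w \<Rightarrow> real) set) \<Rightarrow> 'e set \<Rightarrow> bool" where
  "ess_bounded M nrm G \<longleftrightarrow> (\<exists>c>0. \<forall>g\<in>G. l0_le M (nrm g) (l0_class M (\<lambda>_. c)))"

text \<open>
  A fixed choice of real-valued representatives of the elements of \<open>G\<close>: each \<open>rep x\<close> is a random
  variable whose class in \<open>L\<^sup>0\<close> determines \<open>x\<close>. No relation between this choice and the module
  structure is required.
\<close>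

definition representatives :: "'w measure \<Rightarrow> 'e set \<Rightarrow> ('e \<Rightarrow> 'w \<Rightarrow> real) \<Rightarrow> bool" where
  "representatives M G rep \<longleftrightarrow>
     (\<forall>x\<in>G. rep x \<in> borel_measurable M) \<and> inj_on (\<lambda>x. l0_class M (rep x)) G"

text \<open>
  A fixed choice of representatives \<open>v x\<close> of the classes \<open>nrm x\<close>, with values in \<open>[0,\<infinity>)\<close>
  everywhere and not only almost everywhere.
\<close>

definition norm_representatives ::
  "'w measure \<Rightarrow> ('k, 'e) module \<Rightarrow> ('e \<Rightarrow> ('w \<Rightarrow> real) set) \<Rightarrow> ('e \<Rightarrow> 'w \<Rightarrow> real) \<Rightarrow> bool" where
  "norm_representatives M E nrm v \<longleftrightarrow>
     (\<forall>x\<in>carrier E. v x \<in> nrm x \<and> (\<forall>w\<in>space M. 0 \<le> v x w))"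

definition pointwise_map ::
  "'w measure \<Rightarrow> ('e \<Rightarrow> 'w \<Rightarrow> real) \<Rightarrow> 'e set \<Rightarrow> ('e \<Rightarrow> 'e) \<Rightarrow> bool" where
  "pointwise_map M rep G f \<longleftrightarrow>
     (\<exists>h :: 'w \<times> real \<Rightarrow> real. h \<in> borel_measurable (M \<Otimes>\<^sub>M borel) \<and>
        (\<forall>x\<in>G. AE w in M. rep (f x) w = h (w, rep x w)))"

text \<open>
  Continuity for \<open>(x, y) \<mapsto> \<parallel>x - y\<parallel>(w)\<close> is stated in \<open>\<epsilon>\<close>-\<open>\<delta>\<close> form because, for uncountable \<open>G\<close>, the
  fixed representatives need not satisfy the pseudometric axioms simultaneously at a single \<open>w\<close>.
\<close>

definition fibrewise_continuous ::
  "'w measure \<Rightarrow> ('k, 'e) module \<Rightarrow> ('e \<Rightarrow> 'w \<Rightarrow> real) \<Rightarrow> 'e set \<Rightarrow> ('e \<Rightarrow> 'e) \<Rightarrow> bool" where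
  "fibrewise_continuous M E v G f \<longleftrightarrow>
     (AE w in M. \<forall>x\<in>G. \<forall>e>0. \<exists>d>0. \<forall>y\<in>G.
        v (x \<ominus>\<^bsub>E\<^esub> y) w < d \<longrightarrow> v (f x \<ominus>\<^bsub>E\<^esub> f y) w < e)"

text \<open>
  Functions \<open>[0,\<infinity>) \<rightarrow> [0,\<infinity>)\<close> are functions on \<open>real\<close> whose values at negative arguments are
  irrelevant.
\<close>

definition right_usc :: "(real \<Rightarrow> real) \<Rightarrow> bool" where
  "right_usc \<psi> \<longleftrightarrow> (\<forall>t\<ge>0. \<forall>a>\<psi> t. eventually (\<lambda>s. \<psi> s < a) (at_right t))"

definition boyd_wong :: "(real \<Rightarrow> real) \<Rightarrow> bool" where
  "boyd_wong \<psi> \<longleftrightarrow>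
     \<psi> \<in> {0..} \<rightarrow> {0..} \<and> mono_on {0..} \<psi> \<and> right_usc \<psi> \<and> (\<forall>t>0. \<psi> t < t)"

end

theory Submission
  imports Defs
begin

text \<open>
  The proof is pathwise, on sample points where countably many almost sure statements hold together.
  Fix \<open>x \<in> G\<close>, write \<open>x\<^sub>n\<close> for its iterates, and let \<open>D\<^sub>n(\<omega>)\<close> be the supremum of
  \<open>\<parallel>x\<^sub>i - x\<^sub>j\<parallel>(\<omega>)\<close> over \<open>i, j \<ge> n\<close>. Essential boundedness makes it finite, and since \<open>\<psi>\<^sub>m\<close> is
  nondecreasing the contraction hypothesis gives \<open>D\<^sub>n\<^sub>+\<^sub>m \<le> \<psi>\<^sub>m(D\<^sub>n)\<close>. Let \<open>r = lim D\<^sub>n\<close>. Letting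
  \<open>m \<rightarrow> \<infinity>\<close> with \<open>n\<close> fixed yields \<open>r \<le> \<psi>(D\<^sub>n)\<close>. The \<open>D\<^sub>n\<close> decrease to \<open>r\<close>, so right upper
  semicontinuity of \<open>\<psi>\<close> gives \<open>r \<le> \<psi>(r)\<close>, whence \<open>r = 0\<close>
  (\<open>boyd_wong_iteration_tendsto_0\<close>, \<open>asymptotic_contraction_orbit_Cauchy\<close>).

  Thus almost every path of the orbit is Cauchy, and so the orbit is Cauchy in probability and has a
  limit \<open>p\<close> in \<open>G\<close>. Convergence in probability makes \<open>\<parallel>x\<^sub>n - p\<parallel>(\<omega>)\<close> small for arbitrarily late \<open>n\<close>,
  at almost every \<open>\<omega>\<close>. At such an \<open>n\<close>, fibre-wise continuity puts \<open>x\<^sub>n\<^sub>+\<^sub>1\<close> close to \<open>f p\<close>, while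
  the Cauchy property puts it close to \<open>x\<^sub>n\<close>; hence \<open>f p = p\<close>
  (\<open>fixed_point_if_orbit_converges\<close>).

  If \<open>p\<close> and \<open>q\<close> are fixed points, then \<open>t = \<parallel>q - p\<parallel>(\<omega>)\<close> satisfies \<open>t \<le> \<psi>\<^sub>n(t)\<close> for all
  \<open>n \<ge> 1\<close>, so \<open>t \<le> \<psi>(t)\<close> and \<open>t = 0\<close>. In particular all orbits have the same limit.
\<close>

section \<open>Asymptotic contractions of real distances\<close>

text \<open>
  A positive limit \<open>r\<close> of \<open>D\<close> would satisfy \<open>\<psi> r < r\<close>, and right upper semicontinuity extends
  \<open>\<psi> s < r\<close> to all \<open>s \<ge> r\<close> near \<open>r\<close>, among them some \<open>D n\<close>. But letting \<open>m \<rightarrow> \<infinity>\<close> in the recursive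
  bound shows \<open>r \<le> \<psi> (D n)\<close> for every \<open>n\<close>. Control of \<open>\<psi>\<close> to the right of \<open>r\<close> suffices because
  \<open>D\<close> decreases.
\<close>

lemma boyd_wong_iteration_tendsto_0:
  fixes D :: "nat \<Rightarrow> real"
  assumes nonneg: "\<And>n. 0 \<le> D n" and dec: "decseq D"
    and step: "\<And>m n. m \<ge> 1 \<Longrightarrow> D (n + m) \<le> \<psi>s m (D n)"
    and lim: "\<And>t. t \<ge> 0 \<Longrightarrow> (\<lambda>m. \<psi>s m t) \<longlonglongrightarrow> \<psi> t"
    and bw: "boyd_wong \<psi>"
  shows "D \<longlonglongrightarrow> 0"
proof -
  obtain r where r: "D \<longlonglongrightarrow> r" and r_le: "\<And>n. r \<le> D n"
    using decseq_convergent[OF dec, of 0] nonneg by blast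
  have r_le_psi: "r \<le> \<psi> (D n)" for n
  proof (rule LIMSEQ_le_const[OF lim[OF nonneg]])
    show "\<exists>N. \<forall>m\<ge>N. r \<le> \<psi>s m (D n)"
      using step r_le by (meson order_trans)
  qed
  have "r = 0"
  proof (rule ccontr)
    assume "r \<noteq> 0"
    moreover have "0 \<le> r"
      using r nonneg by (meson LIMSEQ_le_const)
    ultimately have "\<psi> r < r" "0 \<le> r"
      using bw by (auto simp: boyd_wong_def)
    moreover from this have "eventually (\<lambda>s. \<psi> s < r) (at_right r)"
      using bw by (auto simp: boyd_wong_def right_usc_def)
    ultimately obtain b where b: "r < b" "\<And>s. r \<le> s \<Longrightarrow> s < b \<Longrightarrow> \<psi> s < r"
      unfolding eventually_at_right_field by (metis order_le_less)
    have "eventually (\<lambda>n. D n < b) sequentially"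
      using r b(1) by (rule order_tendstoD)
    then obtain n where "D n < b"
      by (auto simp: eventually_sequentially)
    with b(2) r_le have "\<psi> (D n) < r"
      by blast
    with r_le_psi show False
      by (simp add: not_less[symmetric])
  qed
  with r show ?thesis by simp
qed

text \<open>
  Here \<open>d i j\<close> stands for the distance between the \<open>i\<close>-th and \<open>j\<close>-th iterate. Passing to the
  diameters of the tails of the orbit turns the two-index estimate into the one-index recursion of
  the previous lemma; boundedness is what makes these diameters finite.
\<close>

lemma asymptotic_contraction_orbit_Cauchy:
  fixes d :: "nat \<Rightarrow> nat \<Rightarrow> real"
  assumes nonneg: "\<And>i j. 0 \<le> d i j" and bounded: "\<And>i j. d i j \<le> c"
    and contr: "\<And>m i j. m \<ge> 1 \<Longrightarrow> d (i + m) (j + m) \<le> \<psi>s m (d i j)"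
    and mono: "\<And>m. m \<ge> 1 \<Longrightarrow> mono_on {0..} (\<psi>s m)"
    and lim: "\<And>t. t \<ge> 0 \<Longrightarrow> (\<lambda>m. \<psi>s m t) \<longlonglongrightarrow> \<psi> t"
    and bw: "boyd_wong \<psi>"
    and e: "0 < e"
  shows "\<exists>N. \<forall>i\<ge>N. \<forall>j\<ge>N. d i j < e"
proof -
  define D where "D n = (SUP p \<in> {n..} \<times> {n..}. case_prod d p)" for n
  have upper: "d i j \<le> D n" if "n \<le> i" "n \<le> j" for i j n
    unfolding D_def using that
    by (intro cSUP_upper2[where x = "(i, j)"]) (auto intro!: bdd_aboveI[of _ c] bounded)
  have least: "D n \<le> b" if "\<And>i j. n \<le> i \<Longrightarrow> n \<le> j \<Longrightarrow> d i j \<le> b" for n b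
    unfolding D_def using that by (intro cSUP_least) auto
  have D_nonneg: "0 \<le> D n" for n
    using nonneg[of n n] upper[of n n n] by simp
  have "D \<longlonglongrightarrow> 0"
  proof (rule boyd_wong_iteration_tendsto_0[OF D_nonneg _ _ lim bw])
    show "decseq D"
      unfolding decseq_def by (intro allI impI least upper) auto
    fix m n :: nat assume m: "m \<ge> 1"
    show "D (n + m) \<le> \<psi>s m (D n)"
    proof (rule least)
      fix i j assume ij: "n + m \<le> i" "n + m \<le> j"
      have "d i j \<le> \<psi>s m (d (i - m) (j - m))"
        using contr[OF m, of "i - m" "j - m"] ij by simp
      also have "\<dots> \<le> \<psi>s m (D n)"
        using ij by (intro mono_onD[OF mono[OF m]] upper) (auto simp: nonneg D_nonneg)
      finally show "d i j \<le> \<psi>s m (D n)" .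
    qed
  qed auto
  then obtain N where "D N < e"
    using e by (metis order_tendstoD(2) eventually_sequentially order_refl)
  then show ?thesis
    using upper by (meson order_le_less_trans)
qed

section \<open>Real-valued representatives of the random norm\<close>

text \<open>
  A choice \<open>v\<close> of representatives turns identities and inequalities between classes in \<open>L\<^sup>0\<close> into
  almost sure statements about real numbers. The exceptional null set depends on the vectors
  involved, so such statements may be combined at a single sample point for countably many vectors
  only; this is why they are later collected along an orbit.
\<close>

locale rn_module_rep = rn_module M E nrm
  for M :: "'w measure"
    and E :: "(('w \<Rightarrow> 'k::{real_normed_field, second_countable_topology}) set, 'e) module"
    and nrm :: "'e \<Rightarrow> ('w \<Rightarrow> real) set" +
  fixes v :: "'e \<Rightarrow> 'w \<Rightarrow> real"
  assumes norm_reps: "norm_representatives M E nrm v"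
begin

lemma v_in_nrm: "x \<in> carrier E \<Longrightarrow> v x \<in> nrm x"
  and v_nonneg: "x \<in> carrier E \<Longrightarrow> w \<in> space M \<Longrightarrow> 0 \<le> v x w"
  using norm_reps by (auto simp: norm_representatives_def)

lemma nrm_eq_class:
  assumes "x \<in> carrier E"
  shows "nrm x = l0_class M (v x)"
proof -
  obtain f where f: "nrm x = l0_class M f"
    using nrm_nonneg[OF assms] by (auto simp: L0_plus_def)
  with v_in_nrm[OF assms] show ?thesis
    by (auto simp: mem_l0_class l0_class_eq_iff)
qed

lemma v_measurable [measurable]: "x \<in> carrier E \<Longrightarrow> v x \<in> borel_measurable M"
  using v_in_nrm nrm_eq_class by (auto simp: mem_l0_class)

lemma l0_le_class_iff:
  assumes "g \<in> borel_measurable M" "h \<in> borel_measurable M"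
  shows "l0_le M (l0_class M g) (l0_class M h) \<longleftrightarrow> (AE w in M. g w \<le> h w)"
proof
  assume "AE w in M. g w \<le> h w"
  then show "l0_le M (l0_class M g) (l0_class M h)"
    unfolding l0_le_def by (auto simp: mem_l0_class)
qed (use assms in \<open>auto simp: l0_le_def mem_l0_class\<close>)

lemma v_triangle:
  assumes "x \<in> carrier E" "y \<in> carrier E"
  shows "AE w in M. v (x \<oplus>\<^bsub>E\<^esub> y) w \<le> v x w + v y w"
  using nrm_triangle[OF assms] assms
  by (simp add: nrm_eq_class L0_simps l0_le_class_iff)

lemma v_eq_0_imp_zero:
  assumes "x \<in> carrier E" "AE w in M. v x w = 0"
  shows "x = \<zero>\<^bsub>E\<^esub>"
  using assms nrm_eq_zero[OF assms(1)] by (simp add: nrm_eq_class L0_zero l0_class_eq_iff)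

lemma l0_class_minus_one: "\<ominus>\<^bsub>L0 M\<^esub> \<one>\<^bsub>L0 M\<^esub> = l0_class M (\<lambda>_. - 1 :: 'k)"
proof -
  interpret R: cring "L0 M :: ('w \<Rightarrow> 'k) set ring"
    by (rule cring_L0)
  have 1: "l0_class M (\<lambda>_. - 1 :: 'k) \<in> carrier (L0 M)"
    by (auto simp: carrier_L0_iff)
  have 2: "l0_class M (\<lambda>_. - 1 :: 'k) \<oplus>\<^bsub>L0 M\<^esub> \<one>\<^bsub>L0 M\<^esub> = \<zero>\<^bsub>L0 M\<^esub>"
    by (simp add: L0_one L0_zero L0_simps)
  show ?thesis
    by (rule R.minus_equality[OF 2 R.one_closed 1])
qed

lemma l0_abs_class:
  assumes f: "(f :: 'w \<Rightarrow> 'k) \<in> borel_measurable M"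
  shows "l0_abs M (l0_class M f) = l0_class M (\<lambda>w. norm (f w))"
proof -
  have "l0_class M (\<lambda>w. norm (g w)) = l0_class M (\<lambda>w. norm (f w))" if "g \<in> l0_class M f" for g
    using that by (subst l0_class_eq_iff) (auto simp: mem_l0_class)
  moreover have "f \<in> l0_class M f"
    using f by (simp add: mem_l0_class)
  ultimately show ?thesis
    unfolding l0_abs_def by blast
qed

lemma v_uminus:
  assumes x: "x \<in> carrier E"
  shows "AE w in M. v (\<ominus>\<^bsub>E\<^esub> x) w = v x w"
proof -
  interpret R: cring "L0 M :: ('w \<Rightarrow> 'k) set ring"
    by (rule cring_L0)
  have c: "l0_class M (\<lambda>_. - 1 :: 'k) \<in> carrier (L0 M)"
    by (auto simp: carrier_L0_iff)
  have "\<ominus>\<^bsub>E\<^esub> x = l0_class M (\<lambda>_. - 1 :: 'k) \<odot>\<^bsub>E\<^esub> x"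
    using smult_l_minus[OF R.one_closed x] smult_one[OF x] by (simp add: l0_class_minus_one)
  then have "nrm (\<ominus>\<^bsub>E\<^esub> x) = nrm x"
    using nrm_smult[OF c x] x by (simp add: l0_abs_class nrm_eq_class L0_simps)
  then show ?thesis
    using x by (simp add: nrm_eq_class l0_class_eq_iff)
qed

lemma v_diff_commute:
  assumes x: "x \<in> carrier E" and y: "y \<in> carrier E"
  shows "AE w in M. v (x \<ominus>\<^bsub>E\<^esub> y) w = v (y \<ominus>\<^bsub>E\<^esub> x) w"
proof -
  have "\<ominus>\<^bsub>E\<^esub> (y \<ominus>\<^bsub>E\<^esub> x) = x \<ominus>\<^bsub>E\<^esub> y"
    using x y by (simp add: a_minus_def minus_add a_comm)
  with v_uminus[of "y \<ominus>\<^bsub>E\<^esub> x"] x y show ?thesis by simp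
qed

lemma v_diff_triangle:
  assumes x: "x \<in> carrier E" and y: "y \<in> carrier E" and z: "z \<in> carrier E"
  shows "AE w in M. v (x \<ominus>\<^bsub>E\<^esub> z) w \<le> v (x \<ominus>\<^bsub>E\<^esub> y) w + v (y \<ominus>\<^bsub>E\<^esub> z) w"
proof -
  have "(x \<ominus>\<^bsub>E\<^esub> y) \<oplus>\<^bsub>E\<^esub> (y \<ominus>\<^bsub>E\<^esub> z) = x \<ominus>\<^bsub>E\<^esub> z"
    using x y z by (simp add: a_minus_def a_assoc r_neg2 r_neg1)
  with v_triangle[of "x \<ominus>\<^bsub>E\<^esub> y" "y \<ominus>\<^bsub>E\<^esub> z"] x y z show ?thesis by simp
qed

lemma diff_eq_zero_imp_eq:
  assumes x: "x \<in> carrier E" and y: "y \<in> carrier E" and z: "x \<ominus>\<^bsub>E\<^esub> y = \<zero>\<^bsub>E\<^esub>"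
  shows "x = y"
  using x y z by (metis a_minus_def a_inv_closed minus_equality minus_minus)

section \<open>The topology of convergence in probability\<close>

lemma el_nbhd_iff:
  "x \<in> el_nbhd M E nrm \<epsilon> \<delta> \<longleftrightarrow> x \<in> carrier E \<and> prob {w \<in> space M. v x w < \<epsilon>} \<ge> 1 - \<delta>"
proof -
  have "prob {w \<in> space M. r w < \<epsilon>} = prob {w \<in> space M. v x w < \<epsilon>}"
    if "x \<in> carrier E" "r \<in> nrm x" for r
  proof (rule measure_eq_AE)
    have "AE w in M. v x w = r w" and [measurable]: "r \<in> borel_measurable M"
      using that by (auto simp: nrm_eq_class mem_l0_class)
    then show "AE w in M. w \<in> {w \<in> space M. r w < \<epsilon>} \<longleftrightarrow> w \<in> {w \<in> space M. v x w < \<epsilon>}"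
      by auto
    show "{w \<in> space M. r w < \<epsilon>} \<in> events" by measurable
    show "{w \<in> space M. v x w < \<epsilon>} \<in> events" using that by measurable
  qed
  then have "(\<exists>r\<in>nrm x. prob {w \<in> space M. r w < \<epsilon>} \<ge> 1 - \<delta>)
      \<longleftrightarrow> prob {w \<in> space M. v x w < \<epsilon>} \<ge> 1 - \<delta>" if "x \<in> carrier E"
    using that v_in_nrm[OF that] by (metis (no_types, lifting))
  then show ?thesis
    unfolding el_nbhd_def by blast
qed

text \<open>
  The strict inequality \<open>> 1 - \<delta>\<close> is what makes this set open. If \<open>y\<close> lies in it, continuity from
  below of the probability leaves room in both parameters: \<open>\<epsilon>\<close> can be lowered and \<open>\<delta>\<close> reduced by a
  positive amount \<open>\<eta>\<close>, and a perturbation \<open>z\<close> of \<open>y\<close> may use up that room.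
\<close>

lemma el_open_prob_ball:
  assumes p: "p \<in> carrier E" and \<epsilon>: "0 < \<epsilon>"
  shows "el_open M E nrm {y \<in> carrier E. prob {w \<in> space M. v (y \<ominus>\<^bsub>E\<^esub> p) w < \<epsilon>} > 1 - \<delta>}"
    (is "el_open M E nrm ?U")
  unfolding el_open_def
proof (intro conjI ballI)
  show "?U \<subseteq> carrier E" by auto
  fix y assume "y \<in> ?U"
  then have y: "y \<in> carrier E" and gt: "prob {w \<in> space M. v (y \<ominus>\<^bsub>E\<^esub> p) w < \<epsilon>} > 1 - \<delta>"
    by auto
  have yp [simp]: "y \<ominus>\<^bsub>E\<^esub> p \<in> carrier E"
    using y p by simp
  define A where "A k = {w \<in> space M. v (y \<ominus>\<^bsub>E\<^esub> p) w < \<epsilon> - inverse (Suc k)}" for k :: nat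
  have A_event [measurable]: "A k \<in> events" for k
    unfolding A_def using yp by measurable
  have "incseq A"
  proof (rule incseq_SucI)
    fix k
    have "inverse (real (Suc (Suc k))) \<le> inverse (real (Suc k))"
      by (intro le_imp_inverse_le) auto
    then show "A k \<subseteq> A (Suc k)"
      unfolding A_def by (safe, linarith)
  qed
  moreover have "(\<Union>k. A k) = {w \<in> space M. v (y \<ominus>\<^bsub>E\<^esub> p) w < \<epsilon>}"
  proof -
    have "\<exists>k. v (y \<ominus>\<^bsub>E\<^esub> p) w < \<epsilon> - inverse (Suc k)" if "v (y \<ominus>\<^bsub>E\<^esub> p) w < \<epsilon>" for w
      using reals_Archimedean[of "\<epsilon> - v (y \<ominus>\<^bsub>E\<^esub> p) w"] that by (auto simp: algebra_simps)
    moreover have "t < \<epsilon>" if "t < \<epsilon> - inverse (Suc k)" for t and k :: nat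
      using that by (smt (verit) inverse_positive_iff_positive of_nat_0_less_iff zero_less_Suc)
    ultimately show ?thesis
      unfolding A_def by blast
  qed
  ultimately have "(\<lambda>k. prob (A k)) \<longlonglongrightarrow> prob {w \<in> space M. v (y \<ominus>\<^bsub>E\<^esub> p) w < \<epsilon>}"
    using finite_Lim_measure_incseq[of A] A_event by (auto simp: image_subset_iff)
  then obtain k where k: "prob (A k) > 1 - \<delta>"
    using eventually_happens'[OF sequentially_bot order_tendstoD(1)[OF _ gt]] by blast
  \<comment> \<open>Halving the surplus keeps the inequality strict; the cap \<open>1/2\<close> makes \<open>\<eta>\<close> an admissible
    neighbourhood parameter, which has to be below \<open>1\<close>.\<close>
  define \<eta> where "\<eta> = min ((prob (A k) - (1 - \<delta>)) / 2) (1/2)"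
  have \<eta>: "0 < \<eta>" "\<eta> < 1" "prob (A k) - \<eta> > 1 - \<delta>"
    using k by (auto simp: \<eta>_def min_def field_simps)
  have "y \<oplus>\<^bsub>E\<^esub> z \<in> ?U" if "z \<in> el_nbhd M E nrm (inverse (Suc k)) \<eta>" for z
  proof -
    define B where "B = {w \<in> space M. v z w < inverse (Suc k)}"
    have z [simp]: "z \<in> carrier E" and zB: "prob B \<ge> 1 - \<eta>"
      using that by (auto simp: el_nbhd_iff B_def)
    have yzp [simp]: "(y \<oplus>\<^bsub>E\<^esub> z) \<ominus>\<^bsub>E\<^esub> p \<in> carrier E"
      using y p by simp
    have [measurable]: "B \<in> events"
      unfolding B_def using z by measurable
    have eq: "(y \<ominus>\<^bsub>E\<^esub> p) \<oplus>\<^bsub>E\<^esub> z = (y \<oplus>\<^bsub>E\<^esub> z) \<ominus>\<^bsub>E\<^esub> p"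
      using y p z by (simp add: a_minus_def a_ac)
    have "prob (A k) + prob B = prob (A k \<union> B) + prob (A k \<inter> B)"
      by (simp add: measure_Un3 fmeasurable_eq_sets)
    then have "prob (A k) - \<eta> \<le> prob (A k \<inter> B)"
      using zB prob_le_1[of "A k \<union> B"] by linarith
    also have "\<dots> \<le> prob {w \<in> space M. v ((y \<oplus>\<^bsub>E\<^esub> z) \<ominus>\<^bsub>E\<^esub> p) w < \<epsilon>}"
    proof (rule finite_measure_mono_AE)
      show "AE w in M. w \<in> A k \<inter> B \<longrightarrow> w \<in> {w \<in> space M. v ((y \<oplus>\<^bsub>E\<^esub> z) \<ominus>\<^bsub>E\<^esub> p) w < \<epsilon>}"
        using v_triangle[OF yp z] unfolding eq by (auto simp: A_def B_def)
      show "{w \<in> space M. v ((y \<oplus>\<^bsub>E\<^esub> z) \<ominus>\<^bsub>E\<^esub> p) w < \<epsilon>} \<in> events"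
        using yzp by measurable
    qed
    finally show ?thesis
      using \<eta>(3) y by auto
  qed
  with \<eta> show "\<exists>e l. 0 < e \<and> 0 < l \<and> l < 1 \<and> (\<lambda>z. y \<oplus>\<^bsub>E\<^esub> z) ` el_nbhd M E nrm e l \<subseteq> ?U"
    by (intro exI[of _ "inverse (real (Suc k))"] exI[of _ \<eta>]) auto
qed

lemma limitin_imp_prob:
  assumes lim: "limitin (el_topology M E nrm) x p sequentially"
    and \<epsilon>: "0 < \<epsilon>" and \<delta>: "0 < \<delta>"
  shows "eventually (\<lambda>n. x n \<in> carrier E \<and> prob {w \<in> space M. v (x n \<ominus>\<^bsub>E\<^esub> p) w < \<epsilon>} > 1 - \<delta>)
           sequentially"
proof -
  have "topspace (el_topology M E nrm) \<subseteq> carrier E"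
    by (auto simp: topspace_def openin_el_topology el_open_def)
  with lim have p: "p \<in> carrier E"
    by (auto simp: limitin_def)
  have "v \<zero>\<^bsub>E\<^esub> \<in> l0_class M (\<lambda>_. 0)"
    using nrm_eq_zero[of "\<zero>\<^bsub>E\<^esub>"] v_in_nrm[of "\<zero>\<^bsub>E\<^esub>"] by (simp add: L0_zero)
  then have "AE w in M. v \<zero>\<^bsub>E\<^esub> w < \<epsilon>"
    using \<epsilon> by (auto simp: mem_l0_class)
  then have "prob {w \<in> space M. v \<zero>\<^bsub>E\<^esub> w < \<epsilon>} = 1"
    by (subst prob_Collect_eq_1) (auto intro: v_measurable)
  with p \<delta> have "p \<in> {y \<in> carrier E. prob {w \<in> space M. v (y \<ominus>\<^bsub>E\<^esub> p) w < \<epsilon>} > 1 - \<delta>}"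
    by (simp add: a_minus_def r_neg)
  with lim el_open_prob_ball[OF p \<epsilon>, of \<delta>] show ?thesis
    unfolding limitin_def openin_el_topology by fastforce
qed

text \<open>
  Convergence in probability does not give almost sure convergence, but it does give a lower limit
  \<open>0\<close>: the event that some \<open>n \<ge> N\<close> has \<open>v (x n \<ominus> p) < 1 / (k + 1)\<close> contains events of probability
  arbitrarily close to \<open>1\<close>. For an orbit with Cauchy paths this replaces the extraction of an almost
  surely convergent subsequence.
\<close>

lemma limitin_imp_AE_frequently_close:
  assumes lim: "limitin (el_topology M E nrm) x p sequentially"
    and x: "\<And>n. x n \<in> carrier E" and p: "p \<in> carrier E"
  shows "AE w in M. \<forall>e>0. \<forall>N. \<exists>n\<ge>N. v (x n \<ominus>\<^bsub>E\<^esub> p) w < e"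
proof -
  have xp: "x n \<ominus>\<^bsub>E\<^esub> p \<in> carrier E" for n
    using x p by simp
  have "AE w in M. \<exists>n\<ge>N. v (x n \<ominus>\<^bsub>E\<^esub> p) w < inverse (Suc k)" for N k :: nat
  proof -
    define A where "A = {w \<in> space M. \<exists>n\<ge>N. v (x n \<ominus>\<^bsub>E\<^esub> p) w < inverse (Suc k)}"
    have A_event [measurable]: "A \<in> events"
      unfolding A_def using xp by measurable
    have "1 \<le> prob A"
    proof (rule field_le_epsilon)
      fix \<delta> :: real assume "0 < \<delta>"
      have "eventually (\<lambda>n. 1 - \<delta> < prob {w \<in> space M. v (x n \<ominus>\<^bsub>E\<^esub> p) w < inverse (Suc k)})
          sequentially"
        using limitin_imp_prob[OF lim _ \<open>0 < \<delta>\<close>, of "inverse (real (Suc k))"]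
        by (auto elim: eventually_mono)
      then obtain n where n: "N \<le> n"
          "1 - \<delta> < prob {w \<in> space M. v (x n \<ominus>\<^bsub>E\<^esub> p) w < inverse (Suc k)}"
        unfolding eventually_sequentially by (meson nle_le)
      have "prob {w \<in> space M. v (x n \<ominus>\<^bsub>E\<^esub> p) w < inverse (Suc k)} \<le> prob A"
        using n(1) by (intro finite_measure_mono A_event) (auto simp: A_def)
      with n(2) show "1 \<le> prob A + \<delta>" by linarith
    qed
    then have "prob A = 1"
      using prob_le_1[of A] by simp
    then have "AE w in M. w \<in> A"
      by (simp add: prob_eq_1)
    then show ?thesis
      by (auto simp: A_def)
  qed
  then have "AE w in M. \<forall>N k :: nat. \<exists>n\<ge>N. v (x n \<ominus>\<^bsub>E\<^esub> p) w < inverse (Suc k)"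
    by (simp add: AE_all_countable)
  then show ?thesis
  proof eventually_elim
    case (elim w)
    show ?case
    proof (intro allI impI)
      fix e :: real and N :: nat assume "0 < e"
      then obtain k where "inverse (real (Suc k)) < e"
        using reals_Archimedean by blast
      moreover obtain n where "N \<le> n" "v (x n \<ominus>\<^bsub>E\<^esub> p) w < inverse (Suc k)"
        using elim by blast
      ultimately show "\<exists>n\<ge>N. v (x n \<ominus>\<^bsub>E\<^esub> p) w < e"
        by (intro exI[of _ n]) linarith
    qed
  qed
qed

text \<open>
  The events \<open>A N\<close> that all distances beyond \<open>N\<close> are below \<open>\<epsilon>\<close> increase to an event of probability
  \<open>1\<close>, so one of them has probability above \<open>1 - \<delta>\<close>, and it works for all pairs of indices beyond
  \<open>N\<close> at once.
\<close>

lemma AE_Cauchy_imp_el_Cauchy: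
  fixes x :: "nat \<Rightarrow> 'e"
  assumes x: "\<And>n. x n \<in> carrier E"
    and cauchy: "AE w in M. \<forall>e>0. \<exists>N. \<forall>i\<ge>N. \<forall>j\<ge>N. v (x i \<ominus>\<^bsub>E\<^esub> x j) w < e"
    and \<epsilon>: "0 < \<epsilon>" and \<delta>: "0 < \<delta>"
  shows "\<exists>N. \<forall>m\<ge>N. \<forall>n\<ge>N. x m \<ominus>\<^bsub>E\<^esub> x n \<in> el_nbhd M E nrm \<epsilon> \<delta>"
proof -
  have xx: "x i \<ominus>\<^bsub>E\<^esub> x j \<in> carrier E" for i j
    using x by simp
  then have [measurable]: "v (x i \<ominus>\<^bsub>E\<^esub> x j) \<in> borel_measurable M" for i j
    by (rule v_measurable)
  define A where "A N = {w \<in> space M. \<forall>i\<ge>N. \<forall>j\<ge>N. v (x i \<ominus>\<^bsub>E\<^esub> x j) w < \<epsilon>}" for N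
  have A_event [measurable]: "A N \<in> events" for N
    unfolding A_def by measurable
  have "incseq A"
    unfolding incseq_def A_def by fastforce
  then have "(\<lambda>N. prob (A N)) \<longlonglongrightarrow> prob (\<Union>N. A N)"
    by (intro finite_Lim_measure_incseq) auto
  moreover have "prob (\<Union>N. A N) = 1"
  proof (subst prob_eq_1)
    show "AE w in M. w \<in> (\<Union>N. A N)"
      using cauchy AE_space by eventually_elim (use \<epsilon> in \<open>auto simp: A_def\<close>)
  qed measurable
  ultimately obtain N where N: "prob (A N) > 1 - \<delta>"
    using \<delta> eventually_happens'[OF sequentially_bot order_tendstoD(1), of "\<lambda>N. prob (A N)" 1 "1 - \<delta>"]
    by auto
  have "x m \<ominus>\<^bsub>E\<^esub> x n \<in> el_nbhd M E nrm \<epsilon> \<delta>" if "m \<ge> N" "n \<ge> N" for m n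
  proof -
    have "{w \<in> space M. v (x m \<ominus>\<^bsub>E\<^esub> x n) w < \<epsilon>} \<in> events"
      by measurable
    then have "prob (A N) \<le> prob {w \<in> space M. v (x m \<ominus>\<^bsub>E\<^esub> x n) w < \<epsilon>}"
      using that by (intro finite_measure_mono) (auto simp: A_def)
    with N xx show ?thesis
      by (simp add: el_nbhd_iff)
  qed
  then show ?thesis by blast
qed

section \<open>Limits of orbits\<close>

text \<open>
  At a sample point, choose \<open>n\<close> late with \<open>x n\<close> close to \<open>p\<close>. Then \<open>x (Suc n) = f (x n)\<close> is close
  to \<open>f p\<close> by continuity and close to \<open>x n\<close> by the Cauchy property, so \<open>f p\<close> is close to \<open>p\<close>.
\<close>

lemma fixed_point_if_orbit_converges:
  assumes orbit: "\<And>n. x n \<in> G" and Suc: "\<And>n. f (x n) = x (Suc n)"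
    and G: "G \<subseteq> carrier E" "f \<in> G \<rightarrow> G" and p: "p \<in> G"
    and cauchy: "AE w in M. \<forall>e>0. \<exists>N. \<forall>i\<ge>N. \<forall>j\<ge>N. v (x i \<ominus>\<^bsub>E\<^esub> x j) w < e"
    and lim: "limitin (el_topology M E nrm) x p sequentially"
    and cont: "fibrewise_continuous M E v G f"
  shows "f p = p"
proof -
  have xE: "x n \<in> carrier E" and fpE: "f p \<in> carrier E" and pE: "p \<in> carrier E" for n
    using orbit G p by auto
  have close: "AE w in M. \<forall>e>0. \<forall>N. \<exists>n\<ge>N. v (x n \<ominus>\<^bsub>E\<^esub> p) w < e"
    by (rule limitin_imp_AE_frequently_close[OF lim xE pE])
  have comm: "AE w in M. \<forall>n. v (p \<ominus>\<^bsub>E\<^esub> x n) w = v (x n \<ominus>\<^bsub>E\<^esub> p) w"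
    using v_diff_commute[OF pE xE] by (simp add: AE_all_countable)
  have tri: "AE w in M. \<forall>n. v (f p \<ominus>\<^bsub>E\<^esub> p) w
      \<le> v (f p \<ominus>\<^bsub>E\<^esub> x (Suc n)) w + v (x (Suc n) \<ominus>\<^bsub>E\<^esub> p) w"
    using v_diff_triangle[OF fpE xE pE] by (simp add: AE_all_countable)
  have tri': "AE w in M. \<forall>n. v (x (Suc n) \<ominus>\<^bsub>E\<^esub> p) w
      \<le> v (x (Suc n) \<ominus>\<^bsub>E\<^esub> x n) w + v (x n \<ominus>\<^bsub>E\<^esub> p) w"
    using v_diff_triangle[OF xE xE pE] by (simp add: AE_all_countable)
  have "AE w in M. v (f p \<ominus>\<^bsub>E\<^esub> p) w = 0"
    using close comm tri tri' cauchy cont[unfolded fibrewise_continuous_def] AE_space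
  proof eventually_elim
    case (elim w)
    have "v (f p \<ominus>\<^bsub>E\<^esub> p) w \<le> 0 + e" if e: "0 < e" for e
    proof -
      obtain d where d: "d > 0" "\<And>y. y \<in> G \<Longrightarrow> v (p \<ominus>\<^bsub>E\<^esub> y) w < d \<Longrightarrow> v (f p \<ominus>\<^bsub>E\<^esub> f y) w < e / 3"
        using elim(6)[rule_format, OF p, of "e / 3"] e by auto
      obtain N where N: "\<And>i j. N \<le> i \<Longrightarrow> N \<le> j \<Longrightarrow> v (x i \<ominus>\<^bsub>E\<^esub> x j) w < e / 3"
        using elim(5)[rule_format, of "e / 3"] e by auto
      obtain n where n: "N \<le> n" "v (x n \<ominus>\<^bsub>E\<^esub> p) w < min d (e / 3)"
        using elim(1)[rule_format, of "min d (e / 3)" N] d(1) e by auto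
      have "v (f p \<ominus>\<^bsub>E\<^esub> x (Suc n)) w < e / 3"
        using d(2)[OF orbit[of n]] n elim(2) Suc by simp
      moreover have "v (x (Suc n) \<ominus>\<^bsub>E\<^esub> x n) w < e / 3"
        using N n by simp
      ultimately show ?thesis
        using elim(3)[rule_format, of n] elim(4)[rule_format, of n] n by simp
    qed
    then have "v (f p \<ominus>\<^bsub>E\<^esub> p) w \<le> 0"
      by (rule field_le_epsilon)
    with v_nonneg[of "f p \<ominus>\<^bsub>E\<^esub> p" w] elim(7) fpE pE show ?case
      by simp
  qed
  then show ?thesis
    using fpE pE by (intro diff_eq_zero_imp_eq[OF fpE pE v_eq_0_imp_zero]) auto
qed

lemma AE_diff_le_2_ess_bound:
  assumes x: "x \<in> carrier E" and y: "y \<in> carrier E"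
    and bnd_x: "l0_le M (nrm x) (l0_class M (\<lambda>_. c))" and bnd_y: "l0_le M (nrm y) (l0_class M (\<lambda>_. c))"
  shows "AE w in M. v (x \<ominus>\<^bsub>E\<^esub> y) w \<le> 2 * c"
proof -
  have "AE w in M. v x w \<le> c" "AE w in M. v y w \<le> c"
    using bnd_x bnd_y x y by (auto simp: nrm_eq_class l0_le_class_iff)
  moreover have "AE w in M. v (x \<ominus>\<^bsub>E\<^esub> y) w \<le> v x w + v (\<ominus>\<^bsub>E\<^esub> y) w"
    unfolding a_minus_def using x y by (intro v_triangle) auto
  ultimately show ?thesis
    using v_uminus[OF y] by eventually_elim simp
qed

end

section \<open>The fixed point theorem\<close>

theorem corollary4p1:
  fixes M :: "'w measure"
    and E :: "(('w \<Rightarrow> 'k::{real_normed_field, second_countable_topology}) set, 'e) module"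
    and nrm :: "'e \<Rightarrow> ('w \<Rightarrow> real) set"
    and rep v :: "'e \<Rightarrow> 'w \<Rightarrow> real"
    and G :: "'e set"
    and f :: "'e \<Rightarrow> 'e"
    and \<psi>s :: "nat \<Rightarrow> real \<Rightarrow> real"
    and \<psi> :: "real \<Rightarrow> real"
    and \<Omega>0 :: "'w set"
  assumes rn: "rn_module M E nrm"
    and complete: "el_complete M E nrm"
    and G_nonempty: "G \<noteq> {}"
    and G_subset: "G \<subseteq> carrier E"
    and G_closed: "closedin (el_topology M E nrm) G"
    and G_sigma_stable: "sigma_stable M E G"
    and G_bounded: "ess_bounded M nrm G"
    and zero_in_G: "\<zero>\<^bsub>E\<^esub> \<in> G"
    and reps: "representatives M G rep"
    and norm_reps: "norm_representatives M E nrm v"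
    and f_maps: "f \<in> G \<rightarrow> G"
    and f_local: "local_property M E G f"
    and f_pointwise: "pointwise_map M rep G f"
    and f_sigma: "respects_sigma_stability M E G f"
    and f_cont: "fibrewise_continuous M E v G f"
    and psi_maps: "\<And>n. n \<ge> 1 \<Longrightarrow> \<psi>s n \<in> {0..} \<rightarrow> {0..}"
    and psi_mono: "\<And>n. n \<ge> 1 \<Longrightarrow> mono_on {0..} (\<psi>s n)"
    and psi_lim: "uniform_limit {0..} \<psi>s \<psi> sequentially"
    and psi_bw: "boyd_wong \<psi>"
    and Omega0: "\<Omega>0 \<in> sets M" "measure M \<Omega>0 = 1"
    and contraction: "\<And>\<omega> n x y. \<omega> \<in> \<Omega>0 \<Longrightarrow> n \<ge> 1 \<Longrightarrow> x \<in> G \<Longrightarrow> y \<in> G \<Longrightarrow>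
          v ((f ^^ n) x \<ominus>\<^bsub>E\<^esub> (f ^^ n) y) \<omega> \<le> \<psi>s n (v (x \<ominus>\<^bsub>E\<^esub> y) \<omega>)"
  shows "\<exists>p\<in>G. f p = p \<and> (\<forall>q\<in>G. f q = q \<longrightarrow> q = p) \<and>
           (\<forall>x\<in>G. limitin (el_topology M E nrm) (\<lambda>n. (f ^^ n) x) p sequentially)"
proof -
  interpret rn_module_rep M E nrm v
    using rn norm_reps by (simp add: rn_module_rep_def rn_module_rep_axioms_def)
  have lim: "(\<lambda>n. \<psi>s n t) \<longlonglongrightarrow> \<psi> t" if "t \<ge> 0" for t
    using tendsto_uniform_limitI[OF psi_lim] that by simp
  have AE_Omega0: "AE w in M. w \<in> \<Omega>0"
    using Omega0 by (simp add: prob_eq_1)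
  have orbit: "(f ^^ n) x \<in> G" if "x \<in> G" for x n
    using that f_maps by (induction n) auto
  have orbit_E: "(f ^^ n) x \<in> carrier E" if "x \<in> G" for x n
    using orbit[OF that] G_subset by blast
  obtain c where c: "\<And>g. g \<in> G \<Longrightarrow> l0_le M (nrm g) (l0_class M (\<lambda>_. c))"
    using G_bounded by (auto simp: ess_bounded_def)

  have conv: "\<exists>p\<in>G. f p = p \<and> limitin (el_topology M E nrm) (\<lambda>n. (f ^^ n) x) p sequentially"
    if x: "x \<in> G" for x
  proof -
    define X where "X n = (f ^^ n) x" for n
    have XG: "X n \<in> G" and XE: "X n \<in> carrier E" for n
      using x orbit orbit_E by (auto simp: X_def)
    have bounded: "AE w in M. \<forall>i j. v (X i \<ominus>\<^bsub>E\<^esub> X j) w \<le> 2 * c"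
      using AE_diff_le_2_ess_bound[OF XE XE c[OF XG] c[OF XG]] by (simp add: AE_all_countable)
    have cauchy: "AE w in M. \<forall>e>0. \<exists>N. \<forall>i\<ge>N. \<forall>j\<ge>N. v (X i \<ominus>\<^bsub>E\<^esub> X j) w < e"
      using bounded AE_Omega0 AE_space
    proof eventually_elim
      case (elim w)
      show ?case
      proof (intro allI impI, rule asymptotic_contraction_orbit_Cauchy[OF _ _ _ psi_mono lim psi_bw])
        fix i j
        show "0 \<le> v (X i \<ominus>\<^bsub>E\<^esub> X j) w"
          using XE elim(3) by (intro v_nonneg) auto
        show "v (X i \<ominus>\<^bsub>E\<^esub> X j) w \<le> 2 * c"
          using elim(1) by blast
        fix m :: nat assume "m \<ge> 1"
        from contraction[OF elim(2) this XG[of i] XG[of j]]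
        show "v (X (i + m) \<ominus>\<^bsub>E\<^esub> X (j + m)) w \<le> \<psi>s m (v (X i \<ominus>\<^bsub>E\<^esub> X j) w)"
          by (simp add: X_def add.commute[of _ m] funpow_add)
      qed auto
    qed
    obtain p where p: "limitin (el_topology M E nrm) X p sequentially"
      using complete AE_Cauchy_imp_el_Cauchy[OF XE cauchy] XE
      unfolding el_complete_def by blast
    have pG: "p \<in> G"
      by (rule limitin_closedin[OF p G_closed]) (auto simp: XG)
    have "f p = p"
      by (rule fixed_point_if_orbit_converges[OF XG _ G_subset f_maps pG cauchy p f_cont])
        (simp add: X_def)
    with p pG show ?thesis
      unfolding X_def by blast
  qed

  have unique: "q = p" if p: "p \<in> G" "f p = p" and q: "q \<in> G" "f q = q" for p q
  proof -
    have qE: "q \<in> carrier E" and pE: "p \<in> carrier E"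
      using p q G_subset by auto
    have iter: "(f ^^ n) p = p" "(f ^^ n) q = q" for n
      using p q by (induction n) auto
    have "AE w in M. v (q \<ominus>\<^bsub>E\<^esub> p) w = 0"
      using AE_Omega0 AE_space
    proof eventually_elim
      case (elim w)
      define t where "t = v (q \<ominus>\<^bsub>E\<^esub> p) w"
      have t: "0 \<le> t"
        unfolding t_def using qE pE elim by (intro v_nonneg) auto
      have "t \<le> \<psi>s n t" if "n \<ge> 1" for n
        using contraction[OF elim(1) that q(1) p(1)] by (simp add: iter t_def)
      then have "t \<le> \<psi> t"
        by (intro LIMSEQ_le_const[OF lim[OF t]]) blast
      with psi_bw t have "t = 0"
        unfolding boyd_wong_def by (metis leD order_le_less)
      then show ?case by (simp add: t_def)
    qed
    then show ?thesis
      using qE pE by (intro diff_eq_zero_imp_eq[OF qE pE v_eq_0_imp_zero]) auto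
  qed

  obtain p where p: "p \<in> G" "f p = p"
    using conv[OF zero_in_G] by blast
  moreover have "limitin (el_topology M E nrm) (\<lambda>n. (f ^^ n) x) p sequentially" if "x \<in> G" for x
    using conv[OF that] unique[OF p] by blast
  ultimately show ?thesis
    using unique by blast
qed

end
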